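(* Let $a,b$ be nonzero real numbers and let $(q_n)_{n\in\mathbb{Z}}$ and $(l_n)_{n\in\mathbb{Z}}$ be the bi-periodic Fibonacci and bi-periodic Lucas sequences with parameters $a,b$. Then for all integers $m,n$: \begin{itemize} \item[(i)] $(ab+4)\,q_{2(m+n+1)}=l_{2m+1}l_{2(n+1)}+l_{2m}l_{2n+1}$; \item[(ii)] $q_{2(m+n)}=q_{2m}q_{2n+1}+q_{2m-1}q_{2n}$; \item[(iii)] $l_{2(m+n)+1}=l_{2m+1}q_{2n+1}+l_{2m}q_{2n}$; \item[(iv)] $(ab+4)\,q_{2(m-n)}=l_{2m+1}l_{2(n+1)}-l_{2(m+1)}l_{2n+1}$; \item[(v)] $q_{2(m-n)}=q_{2m}q_{2n+1}-q_{2m+1}q_{2n}$; \item[(vi)] $l_{2(m-n)+1}=q_{2(m+1)}l_{2n}-q_{2m+1}l_{2n+1}$. \end{itemize}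
   Context: The bi-periodic Fibonacci sequence $(q_n)$ is defined by $q_0=0$, $q_1=1$, and $q_n=aq_{n-1}+q_{n-2}$ if $n$ is even, $q_n=bq_{n-1}+q_{n-2}$ if $n$ is odd. The bi-periodic Lucas sequence $(l_n)$ is defined by $l_0=2$, $l_1=a$, and $l_n=bl_{n-1}+l_{n-2}$ if $n$ is even, $l_n=al_{n-1}+l_{n-2}$ if $n$ is odd. These recurrences are required to hold for all integers $n$, which extends both sequences uniquely to negative indices. *)

theory Defs
  imports Complex_Main
begin

definition biperiodic_fibonacci :: "real \<Rightarrow> real \<Rightarrow> (int \<Rightarrow> real) \<Rightarrow> bool" where
  "biperiodic_fibonacci a b q \<longleftrightarrow>
     q 0 = 0 \<and> q 1 = 1 \<and>
     (\<forall>n. q n = (if even n then a else b) * q (n - 1) + q (n - 2))"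

definition biperiodic_lucas :: "real \<Rightarrow> real \<Rightarrow> (int \<Rightarrow> real) \<Rightarrow> bool" where
  "biperiodic_lucas a b l \<longleftrightarrow>
     l 0 = 2 \<and> l 1 = a \<and>
     (\<forall>n. l n = (if even n then b else a) * l (n - 1) + l (n - 2))"

text \<open>The two predicates each determine exactly one two-sided sequence, for all \<open>a\<close> and \<open>b\<close>.\<close>

fun biperiodic_nat :: "real \<Rightarrow> real \<Rightarrow> real \<Rightarrow> real \<Rightarrow> nat \<Rightarrow> real" where
  "biperiodic_nat c d x y 0 = x"
| "biperiodic_nat c d x y (Suc 0) = y"
| "biperiodic_nat c d x y (Suc (Suc k)) =
     (if even k then c else d) * biperiodic_nat c d x y (Suc k) + biperiodic_nat c d x y k"

lemma biperiodic_exists: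
  fixes c d x y :: real
  shows "\<exists>f :: int \<Rightarrow> real. f 0 = x \<and> f 1 = y \<and>
           (\<forall>n. f n = (if even n then c else d) * f (n - 1) + f (n - 2))"
proof -
  define F where "F = biperiodic_nat c d x y"
  define G where "G = biperiodic_nat (- c) (- d) x (y - d * x)"
  define f :: "int \<Rightarrow> real" where "f = (\<lambda>n. if n \<ge> 0 then F (nat n) else G (nat (- n)))"
  have pos: "f (int k) = F k" for k
    by (simp add: f_def)
  have neg: "f (- int k) = G k" for k
    by (cases k) (simp_all add: f_def F_def G_def nat_add_distrib)
  have "f n = (if even n then c else d) * f (n - 1) + f (n - 2)" for n
  proof -
    consider "n \<ge> 2" | "n = 1" | "n \<le> 0" by linarith
    then show ?thesis
    proof cases
      case 1
      define k where "k = nat (n - 2)"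
      have n: "n = int (Suc (Suc k))" "n - 1 = int (Suc k)" "n - 2 = int k"
        using 1 by (auto simp: k_def)
      have "even n \<longleftrightarrow> even k"
        unfolding n(1) by simp
      then show ?thesis
        unfolding n(2,3) pos by (simp only: n(1) pos) (simp add: F_def)
    next
      case 2
      have "f 1 = y" "f 0 = x" "f (- 1) = y - d * x"
        using pos[of 1] pos[of 0] neg[of 1] by (simp_all add: F_def G_def)
      with 2 show ?thesis by simp
    next
      case 3
      define k where "k = nat (- n)"
      have n: "n = - int k" "n - 1 = - int (Suc k)" "n - 2 = - int (Suc (Suc k))"
        using 3 by (auto simp: k_def)
      have "even n \<longleftrightarrow> even k"
        unfolding n(1) by simp
      then show ?thesis
        unfolding n(2,3) neg by (simp only: n(1) neg) (simp add: G_def)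
    qed
  qed
  moreover have "f 0 = x" "f 1 = y"
    using pos[of 0] pos[of 1] by (simp_all add: F_def)
  ultimately show ?thesis by blast
qed

lemma biperiodic_unique:
  fixes f g :: "int \<Rightarrow> real"
  assumes f: "\<And>n. f n = (if even n then c else d) * f (n - 1) + f (n - 2)"
    and g: "\<And>n. g n = (if even n then c else d) * g (n - 1) + g (n - 2)"
    and "f 0 = g 0" "f 1 = g 1"
  shows "f = g"
proof
  fix n :: int
  have "f n = g n \<and> f (n + 1) = g (n + 1)"
  proof (induction n rule: int_induct[of _ 0])
    case base
    show ?case using assms(3,4) by simp
  next
    case (step1 i)
    then show ?case using f[of "i + 2"] g[of "i + 2"] by (simp add: add_ac)
  next
    case (step2 i)
    then show ?case using f[of "i + 1"] g[of "i + 1"] by auto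
  qed
  then show "f n = g n" ..
qed

lemma biperiodic_fibonacci_ex1: "\<exists>!q. biperiodic_fibonacci a b q"
proof (rule ex_ex1I)
  show "\<exists>q. biperiodic_fibonacci a b q"
    unfolding biperiodic_fibonacci_def by (rule biperiodic_exists)
next
  fix q q' assume "biperiodic_fibonacci a b q" "biperiodic_fibonacci a b q'"
  then show "q = q'"
    unfolding biperiodic_fibonacci_def
    by (elim conjE, intro biperiodic_unique[of q a b q']) (blast | (erule ssubst)+, rule refl)+
qed

lemma biperiodic_lucas_ex1: "\<exists>!l. biperiodic_lucas a b l"
proof (rule ex_ex1I)
  show "\<exists>l. biperiodic_lucas a b l"
    unfolding biperiodic_lucas_def by (rule biperiodic_exists)
next
  fix l l' assume "biperiodic_lucas a b l" "biperiodic_lucas a b l'"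
  then show "l = l'"
    unfolding biperiodic_lucas_def
    by (elim conjE, intro biperiodic_unique[of l b a l']) (blast | (erule ssubst)+, rule refl)+
qed

end

theory Submission
  imports Defs
begin

text \<open>
  Along indices of fixed parity, a bi-periodic sequence satisfies the constant-coefficient
  recurrence \<open>x(k+2) = (a b + 2) x(k+1) - x(k)\<close>, which is symmetric under \<open>k \<mapsto> -k\<close>.
  So with one of \<open>m\<close>, \<open>n\<close> fixed, both sides of each identity solve this recurrence in the other,
  and it suffices to compare them at \<open>0\<close> and \<open>1\<close>. There, thanks to
  \<open>l(n) = q(n-1) + q(n+1)\<close>, everything is a combination of two consecutive values of \<open>q\<close>.
\<close>

text \<open>The coefficient of \<open>f k\<close> is -1, a unit, so the recurrence can be run in
  both directions without division. Two consecutive values thus determine the sequence on all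
  integers, over any commutative ring.\<close>

lemma second_order_unique:
  fixes f g :: "int \<Rightarrow> 'a::comm_ring_1"
  assumes f: "\<And>k. f (k + 2) = c * f (k + 1) - f k"
    and g: "\<And>k. g (k + 2) = c * g (k + 1) - g k"
    and "f 0 = g 0" "f 1 = g 1"
  shows "f k = g k"
proof -
  have "f k = g k \<and> f (k + 1) = g (k + 1)"
  proof (induction k rule: int_induct[of _ 0])
    case base
    show ?case using assms(3,4) by simp
  next
    case (step1 i)
    then show ?case using f[of i] g[of i] by (simp add: add_ac)
  next
    case (step2 i)
    \<comment> \<open>The recurrence at \<open>i - 1\<close>, solved for its lowest term.\<close>
    have "f (i - 1) = c * f i - f (i + 1)" "g (i - 1) = c * g i - g (i + 1)"
      using f[of "i - 1"] g[of "i - 1"] by (simp_all add: algebra_simps)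
    with step2 show ?case by simp
  qed
  then show ?thesis ..
qed

text \<open>The two terms at odd distance from \<open>n\<close> are eliminated from three
  consecutive instances of the recurrence. The parity of \<open>n\<close> only swaps
  \<open>c\<close> and \<open>d\<close>, and the resulting coefficient is symmetric in them.\<close>

lemma biperiodic_step_two:
  fixes f :: "int \<Rightarrow> real"
  assumes f: "\<And>n. f n = (if even n then c else d) * f (n - 1) + f (n - 2)"
  shows "f (n + 4) = (c * d + 2) * f (n + 2) - f n"
proof -
  have "f (n + 4) = (if even n then c else d) * f (n + 3) + f (n + 2)"
    "f (n + 3) = (if even n then d else c) * f (n + 2) + f (n + 1)"
    "f (n + 2) = (if even n then c else d) * f (n + 1) + f n"
    using f[of "n + 4"] f[of "n + 3"] f[of "n + 2"] by (simp_all add: algebra_simps)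
  then show ?thesis by (cases "even n") (simp_all add: algebra_simps)
qed

text \<open>A shift by one flips parity, so the sum of the two neighbours in \<open>q\<close> obeys
  the recurrence with \<open>a\<close> and \<open>b\<close> exchanged, which is that of
  \<open>l\<close>. It then suffices to match the values at 0 and 1.\<close>

lemma lucas_eq_fibonacci_neighbours:
  assumes "biperiodic_fibonacci a b q" "biperiodic_lucas a b l"
  shows "l n = q (n - 1) + q (n + 1)"
proof -
  have q: "q n = (if even n then a else b) * q (n - 1) + q (n - 2)" "q 0 = 0" "q 1 = 1" for n
    using assms(1) unfolding biperiodic_fibonacci_def by blast+
  have l: "l n = (if even n then b else a) * l (n - 1) + l (n - 2)" "l 0 = 2" "l 1 = a" for n
    using assms(2) unfolding biperiodic_lucas_def by blast+
  have "l = (\<lambda>n. q (n - 1) + q (n + 1))"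
  proof (rule biperiodic_unique[of l b a])
    show "l n = (if even n then b else a) * l (n - 1) + l (n - 2)" for n by (rule l(1))
    show "q (n - 1) + q (n + 1) = (if even n then b else a) * (q (n - 1 - 1) + q (n - 1 + 1))
        + (q (n - 2 - 1) + q (n - 2 + 1))" for n
      using q(1)[of "n - 1"] q(1)[of "n + 1"] by (simp add: algebra_simps)
    show "l 0 = q (0 - 1) + q (0 + 1)" using q(1)[of 1] q(2,3) l(2) by simp
    show "l 1 = q (1 - 1) + q (1 + 1)" using q(1)[of 2] q(2,3) l(3) by simp
  qed
  then show ?thesis by (rule fun_cong)
qed

theorem theorem6:
  fixes a b :: real and q l :: "int \<Rightarrow> real" and m n :: int
  assumes "a \<noteq> 0" and "b \<noteq> 0"
    and "biperiodic_fibonacci a b q" and "biperiodic_lucas a b l"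
  shows "((a * b + 4) * q (2 * (m + n + 1)) = l (2 * m + 1) * l (2 * (n + 1)) + l (2 * m) * l (2 * n + 1)) \<and>
    (q (2 * (m + n)) = q (2 * m) * q (2 * n + 1) + q (2 * m - 1) * q (2 * n)) \<and>
    (l (2 * (m + n) + 1) = l (2 * m + 1) * q (2 * n + 1) + l (2 * m) * q (2 * n)) \<and>
    ((a * b + 4) * q (2 * (m - n)) = l (2 * m + 1) * l (2 * (n + 1)) - l (2 * (m + 1)) * l (2 * n + 1)) \<and>
    (q (2 * (m - n)) = q (2 * m) * q (2 * n + 1) - q (2 * m + 1) * q (2 * n)) \<and>
    (l (2 * (m - n) + 1) = q (2 * (m + 1)) * l (2 * n) - q (2 * m + 1) * l (2 * n + 1))"
proof -
  define c where "c = a * b + 2"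
  have q: "q n = (if even n then a else b) * q (n - 1) + q (n - 2)"
    and q0: "q 0 = 0" and q1: "q 1 = 1" for n
    using assms(3) unfolding biperiodic_fibonacci_def by blast+
  have l: "l n = (if even n then b else a) * l (n - 1) + l (n - 2)"
    and l0: "l 0 = 2" and l1: "l 1 = a" for n
    using assms(4) unfolding biperiodic_lucas_def by blast+
  have q_step: "q (n + 4) = c * q (n + 2) - q n" for n
    unfolding c_def by (rule biperiodic_step_two[OF q])
  have l_step: "l (n + 4) = c * l (n + 2) - l n" for n
    using biperiodic_step_two[OF l] by (simp add: c_def mult.commute)
  \<comment> \<open>Nearby values in terms of \<open>q (2 * k)\<close> and
    \<open>q (2 * k + 1)\<close>. Together with \<open>l_at\<close>, this turns each check at 0 or 1
    into a polynomial identity in these two values, \<open>a\<close> and \<open>b\<close>.\<close>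
  have q_at: "q (2 * k + 2) = a * q (2 * k + 1) + q (2 * k)"
    "q (2 * k + 3) = (a * b + 1) * q (2 * k + 1) + b * q (2 * k)"
    "q (2 * k + 4) = a * (a * b + 2) * q (2 * k + 1) + (a * b + 1) * q (2 * k)"
    "q (2 * k - 1) = q (2 * k + 1) - b * q (2 * k)"
    "q (2 * k - 2) = (a * b + 1) * q (2 * k) - a * q (2 * k + 1)" for k
    using q[of "2 * k + 2"] q[of "2 * k + 3"] q[of "2 * k + 4"] q[of "2 * k + 1"] q[of "2 * k"]
    by (simp_all add: algebra_simps)
  have l_at: "l (2 * k) = q (2 * k - 1) + q (2 * k + 1)"
    "l (2 * k + 1) = q (2 * k) + q (2 * k + 2)"
    "l (2 * k + 2) = q (2 * k + 1) + q (2 * k + 3)"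
    "l (2 * k + 3) = q (2 * k + 2) + q (2 * k + 4)"
    "l (2 * k - 1) = q (2 * k - 2) + q (2 * k)" for k
    using lucas_eq_fibonacci_neighbours[OF assms(3,4)] by (simp_all add: algebra_simps)
  \<comment> \<open>The factors that become explicit once the running index is 0 or 1;
    \<open>l 4\<close> comes from \<open>l (2 * (k + 1))\<close> at \<open>k = 1\<close>.\<close>
  have init: "q 0 = 0" "q 1 = 1" "q (- 1) = 1" "q 2 = a" "q 3 = a * b + 1"
    "l 0 = 2" "l 1 = a" "l 2 = a * b + 2" "l 3 = a * (a * b + 3)" "l 4 = a * b * (a * b + 4) + 2"
    using q[of 1] q[of 2] q[of 3] l[of 2] l[of 3] l[of 4]
    by (simp_all add: q0 q1 l0 l1 algebra_simps)
  have id1: "(a * b + 4) * q (2 * (m + n + 1)) = l (2 * m + 1) * l (2 * (n + 1)) + l (2 * m) * l (2 * n + 1)"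
  \<comment> \<open>Cases 1 and 2 are the recurrences of the two sides, cases 3 and 4 their values
    at 0 and 1. Raising \<open>k\<close> by one moves every index by 2, and factors free of
    \<open>k\<close> are constants, so linearity gives case 2.\<close>
  proof (rule second_order_unique[where c = c and k = m and f = "\<lambda>k. (a * b + 4) * q (2 * (k + n + 1))"
        and g = "\<lambda>k. l (2 * k + 1) * l (2 * (n + 1)) + l (2 * k) * l (2 * n + 1)"], goal_cases)
    case (1 k)
    show ?case
      using q_step[of "2 * k + 2 * n + 2"]
      by (simp add: algebra_simps; algebra)
  next
    case (2 k)
    show ?case
      using l_step[of "2 * k + 1"] l_step[of "2 * k"]
      by (simp add: algebra_simps; algebra)
  next
    case 3
    show ?case
      using q_at[of n] l_at[of n]
      by (simp add: init algebra_simps; algebra)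
  next
    case 4
    show ?case
      using q_at[of n] l_at[of n]
      by (simp add: init algebra_simps; algebra)
  qed
  have id2: "q (2 * (m + n)) = q (2 * m) * q (2 * n + 1) + q (2 * m - 1) * q (2 * n)"
  proof (rule second_order_unique[where c = c and k = m and f = "\<lambda>k. q (2 * (k + n))"
        and g = "\<lambda>k. q (2 * k) * q (2 * n + 1) + q (2 * k - 1) * q (2 * n)"], goal_cases)
    case (1 k)
    show ?case
      using q_step[of "2 * k + 2 * n"]
      by (simp add: algebra_simps; algebra)
  next
    case (2 k)
    show ?case
      using q_step[of "2 * k"] q_step[of "2 * k - 1"]
      by (simp add: algebra_simps; algebra)
  next
    case 3
    show ?case
      using q_at[of n] l_at[of n]
      by (simp add: init algebra_simps; algebra)
  next
    case 4
    show ?case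
      using q_at[of n] l_at[of n]
      by (simp add: init algebra_simps; algebra)
  qed
  have id3: "l (2 * (m + n) + 1) = l (2 * m + 1) * q (2 * n + 1) + l (2 * m) * q (2 * n)"
  proof (rule second_order_unique[where c = c and k = n and f = "\<lambda>k. l (2 * (m + k) + 1)"
        and g = "\<lambda>k. l (2 * m + 1) * q (2 * k + 1) + l (2 * m) * q (2 * k)"], goal_cases)
    case (1 k)
    show ?case
      using l_step[of "2 * m + 2 * k + 1"]
      by (simp add: algebra_simps; algebra)
  next
    case (2 k)
    show ?case
      using q_step[of "2 * k + 1"] q_step[of "2 * k"]
      by (simp add: algebra_simps; algebra)
  next
    case 3
    show ?case
      using q_at[of m] l_at[of m]
      by (simp add: init algebra_simps; algebra)
  next
    case 4
    show ?case
      using q_at[of m] l_at[of m]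
      by (simp add: init algebra_simps; algebra)
  qed
  have id4: "(a * b + 4) * q (2 * (m - n)) = l (2 * m + 1) * l (2 * (n + 1)) - l (2 * (m + 1)) * l (2 * n + 1)"
  proof (rule second_order_unique[where c = c and k = n and f = "\<lambda>k. (a * b + 4) * q (2 * (m - k))"
        and g = "\<lambda>k. l (2 * m + 1) * l (2 * (k + 1)) - l (2 * (m + 1)) * l (2 * k + 1)"], goal_cases)
    case (1 k)
    show ?case
      \<comment> \<open>Here the index falls as \<open>k\<close> grows, so the instance starts at
        the term for \<open>k + 2\<close>; the symmetry of the recurrence under reversal does the
        rest.\<close>
      using q_step[of "2 * m - 2 * k - 4"]
      by (simp add: algebra_simps; algebra)
  next
    case (2 k)
    show ?case
      using l_step[of "2 * k + 2"] l_step[of "2 * k + 1"]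
      by (simp add: algebra_simps; algebra)
  next
    case 3
    show ?case
      using q_at[of m] l_at[of m]
      by (simp add: init algebra_simps; algebra)
  next
    case 4
    show ?case
      using q_at[of m] l_at[of m]
      by (simp add: init algebra_simps; algebra)
  qed
  have id5: "q (2 * (m - n)) = q (2 * m) * q (2 * n + 1) - q (2 * m + 1) * q (2 * n)"
  proof (rule second_order_unique[where c = c and k = n and f = "\<lambda>k. q (2 * (m - k))"
        and g = "\<lambda>k. q (2 * m) * q (2 * k + 1) - q (2 * m + 1) * q (2 * k)"], goal_cases)
    case (1 k)
    show ?case
      using q_step[of "2 * m - 2 * k - 4"]
      by (simp add: algebra_simps; algebra)
  next
    case (2 k)
    show ?case
      using q_step[of "2 * k + 1"] q_step[of "2 * k"]
      by (simp add: algebra_simps; algebra)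
  next
    case 3
    show ?case
      using q_at[of m] l_at[of m]
      by (simp add: init algebra_simps; algebra)
  next
    case 4
    show ?case
      using q_at[of m] l_at[of m]
      by (simp add: init algebra_simps; algebra)
  qed
  have id6: "l (2 * (m - n) + 1) = q (2 * (m + 1)) * l (2 * n) - q (2 * m + 1) * l (2 * n + 1)"
  proof (rule second_order_unique[where c = c and k = n and f = "\<lambda>k. l (2 * (m - k) + 1)"
        and g = "\<lambda>k. q (2 * (m + 1)) * l (2 * k) - q (2 * m + 1) * l (2 * k + 1)"], goal_cases)
    case (1 k)
    show ?case
      \<comment> \<open>Again the lowest index, \<open>2 * (m - (k + 2)) + 1\<close>, belongs to
        \<open>k + 2\<close>.\<close>
      using l_step[of "2 * m - 2 * k - 3"]
      by (simp add: algebra_simps; algebra)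
  next
    case (2 k)
    show ?case
      using l_step[of "2 * k + 1"] l_step[of "2 * k"]
      by (simp add: algebra_simps; algebra)
  next
    case 3
    show ?case
      using q_at[of m] l_at[of m]
      by (simp add: init algebra_simps; algebra)
  next
    case 4
    show ?case
      using q_at[of m] l_at[of m]
      by (simp add: init algebra_simps; algebra)
  qed
  show ?thesis
    by (intro conjI id1 id2 id3 id4 id5 id6)
qed

end
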